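(* Let $r\geq 2$ be an integer. For the star $K_{1,r-1}$ on $r$ vertices, $\pi_{K_{1,r-1}}(\mathcal{T}_r)=\frac{r-2}{r-1}$.
   Context: Graphs are finite and simple; $K_{1,r-1}$ is the star with one centre joined to $r-1$ leaves. Let $H$ be a host graph. A (weighted) $H$-partite graph is a graph $G$ together with a canonical partition $V(G)=\bigsqcup_{x\in V(H)}V_x$ and a weight function $w:V(G)\to[0,1]$ such that (1) $\sum_{v\in V_x}w(v)=1$ for each $x\in V(H)$; (2) every edge of $G$ joins a vertex of $V_x$ to a vertex of $V_y$ for some $xy\in E(H)$. For $xy\in E(H)$ put $\alpha_{xy}:=\sum_{u\in V_x,\,v\in V_y}w(u)w(v)\mathbb{1}_{uv\in E(G)}$; the $H$-partite density of $G$ is $d_H(G):=\min\{\alpha_{xy}: xy\in E(H)\}$. A transversal of $G$ is a subgraph of $G$ induced by a set of vertices meeting each part $V_x$ in exactly one vertex (it is naturally viewed as a spanning subgraph of $H$). For a family $\mathcal{F}$ of graphs, $G$ has $\mathcal{F}$-free transversals if no transversal of $G$ contains a member of $\mathcal{F}$ as a subgraph, and $$\pi_H(\mathcal{F}):=\sup\{d_H(G): G\text{ is an }H\text{-partite graph with }\mathcal{F}\text{-free transversals}\}.$$ $\mathcal{T}_r$ denotes the family of all trees on $r$ vertices; thus for an $r$-vertex host graph $H$, $G$ has $\mathcal{T}_r$-free transversals if and only if no transversal of $G$ is connected. *)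

theory Defs
  imports Complex_Main "HOL-Library.Disjoint_Sets" "Graph_Theory.Graph_Theory"
begin

text \<open>
  A finite simple graph is a \<^locale>\<open>pair_graph\<close>: a finite, loopless digraph with a
  symmetric arc relation, so that each edge \<open>uv\<close> is represented by the two arcs \<open>(u, v)\<close>
  and \<open>(v, u)\<close>.
\<close>

text \<open>
  Host vertices index the parts: \<open>V x\<close> is the part belonging to the vertex \<open>x\<close> of \<open>H\<close>.
  Values of \<open>V\<close> outside \<open>H\<close> and of \<open>w\<close> outside \<open>G\<close> are irrelevant.
\<close>

definition partite_graph ::
    "'a pair_pre_digraph \<Rightarrow> 'b pair_pre_digraph \<Rightarrow> ('a \<Rightarrow> 'b set) \<Rightarrow> ('b \<Rightarrow> real) \<Rightarrow> bool" where
  "partite_graph H G V w \<longleftrightarrow>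
     pair_graph G \<and>
     pverts G = (\<Union>x\<in>pverts H. V x) \<and> disjoint_family_on V (pverts H) \<and>
     (\<forall>v\<in>pverts G. 0 \<le> w v \<and> w v \<le> 1) \<and>
     (\<forall>x\<in>pverts H. (\<Sum>v\<in>V x. w v) = 1) \<and>
     (\<forall>(u, v)\<in>parcs G. \<exists>(x, y)\<in>parcs H. u \<in> V x \<and> v \<in> V y)"

definition edge_density ::
    "'b pair_pre_digraph \<Rightarrow> ('a \<Rightarrow> 'b set) \<Rightarrow> ('b \<Rightarrow> real) \<Rightarrow> 'a \<Rightarrow> 'a \<Rightarrow> real" where
  "edge_density G V w x y =
     (\<Sum>u\<in>V x. \<Sum>v\<in>V y. w u * w v * of_bool ((u, v) \<in> parcs G))"

definition partite_density ::
    "'a pair_pre_digraph \<Rightarrow> 'b pair_pre_digraph \<Rightarrow> ('a \<Rightarrow> 'b set) \<Rightarrow> ('b \<Rightarrow> real) \<Rightarrow> real" where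
  "partite_density H G V w = Min ((\<lambda>(x, y). edge_density G V w x y) ` parcs H)"

definition transversals ::
    "'a pair_pre_digraph \<Rightarrow> 'b pair_pre_digraph \<Rightarrow> ('a \<Rightarrow> 'b set) \<Rightarrow> ('b, 'b \<times> 'b) pre_digraph set"
  where
  "transversals H G V =
     {with_proj G \<restriction> S | S. S \<subseteq> pverts G \<and> (\<forall>x\<in>pverts H. \<exists>!v. v \<in> S \<inter> V x)}"

text \<open>
  A graph contains \<open>F\<close> as a subgraph if it has a subgraph isomorphic to \<open>F\<close>.
  (An isomorphic image of a symmetric digraph is symmetric, so the subgraph found is
  again an undirected graph.)
\<close>

definition contains_copy :: "('b, 'c) pre_digraph \<Rightarrow> ('d, 'e) pre_digraph \<Rightarrow> bool" where
  "contains_copy G F \<longleftrightarrow> (\<exists>S. subgraph S G \<and> digraph_iso F S)"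

definition free_transversals ::
    "'c pair_pre_digraph set \<Rightarrow> 'a pair_pre_digraph \<Rightarrow> 'b pair_pre_digraph \<Rightarrow> ('a \<Rightarrow> 'b set) \<Rightarrow> bool"
  where
  "free_transversals \<F> H G V \<longleftrightarrow>
     (\<forall>T\<in>transversals H G V. \<forall>F\<in>\<F>. \<not> contains_copy T (with_proj F))"

text \<open>
  Since finite graphs are considered, taking the vertices of \<open>G\<close> to be natural numbers loses
  no generality up to isomorphism.
\<close>

definition partite_turan_density :: "'a pair_pre_digraph \<Rightarrow> 'c pair_pre_digraph set \<Rightarrow> real" where
  "partite_turan_density H \<F> =
     Sup {partite_density H G V w | (G :: nat pair_pre_digraph) V w.
            partite_graph H G V w \<and> free_transversals \<F> H G V}"

text \<open>
  The library predicate \<^const>\<open>tree\<close> cannot be used for a symmetric digraph: there the closed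
  walk \<open>a, b, a\<close> along a single edge counts as a cycle. The cycles of the undirected graph are
  the cycles of length at least 3.
\<close>

definition undirected_tree :: "'a pair_pre_digraph \<Rightarrow> bool" where
  "undirected_tree T \<longleftrightarrow>
     pair_graph T \<and> connected (with_proj T) \<and>
     \<not> (\<exists>p. pre_digraph.cycle (with_proj T) p \<and> 3 \<le> length p)"

definition trees :: "nat \<Rightarrow> nat pair_pre_digraph set" where
  "trees r = {T. undirected_tree T \<and> card (pverts T) = r}"

end

theory Submission
  imports Defs
begin

text \<open>
  The host is a star with a centre \<open>c\<close> and \<open>n = r - 1\<close> leaves.  A transversal picks one vertex
  \<open>u\<close> of the central part and one vertex of each leaf part, and all its edges run between \<open>u\<close>
  and the leaf parts, so it is connected exactly if \<open>u\<close> is adjacent to all the other vertices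
  picked.  Hence all transversals are disconnected if and only if every vertex \<open>u\<close> of the central
  part \<^emph>\<open>misses\<close> some leaf part, that is, has no neighbour in it
  (\<open>free_transversals_star_iff\<close>).

  Upper bound: a vertex \<open>u\<close> of the central part sees weight at most \<open>1\<close> in each leaf part and
  weight \<open>0\<close> in the one that it misses, so it sees at most \<open>n - 1\<close> in total.  Averaging over
  \<open>u\<close>, the \<open>n\<close> edge densities sum to at most \<open>n - 1\<close>, and the least of them is at most
  \<open>(n - 1) / n\<close> (\<open>partite_density_star_le\<close>).

  Lower bound: let the central part consist of \<open>n\<close> vertices of weight \<open>1 / n\<close>, let each leaf
  part be a single vertex, and let the \<open>i\<close>-th central vertex miss precisely the \<open>i\<close>-th leaf.
  All densities are then \<open>(n - 1) / n\<close> (\<open>extremal_star_graph\<close>).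
\<close>

section \<open>Copies of trees\<close>

text \<open>The copy is the image of the map; it need not be an induced subgraph of \<open>T\<close>.\<close>

lemma contains_copyI:
  assumes F: "pair_wf_digraph F" and T: "wf_digraph T" "tail T = fst" "head T = snd"
    and inj: "inj_on \<phi> (pverts F)" and verts: "\<phi> ` pverts F \<subseteq> verts T"
    and arcs: "\<And>i j. (i, j) \<in> parcs F \<Longrightarrow> (\<phi> i, \<phi> j) \<in> arcs T"
  shows "contains_copy T (with_proj F)"
proof -
  interpret F: pair_wf_digraph F by (fact F)
  define f where "f = \<lparr> iso_verts = \<phi>, iso_arcs = map_prod \<phi> \<phi>, iso_head = snd, iso_tail = fst \<rparr>"
  have "inj_on (map_prod \<phi> \<phi>) (parcs F)"
    using inj F.in_arcsD1 F.in_arcsD2 by (auto simp: inj_on_def)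
  then have iso: "F.digraph_isomorphism f"
    using inj F.wf_digraph by (auto simp: F.digraph_isomorphism_def f_def)
  have "wf_digraph (app_iso f (with_proj F))"
    using iso by (rule F.wf_digraphI_app_iso)
  then have "subgraph (app_iso f (with_proj F)) T"
    using T verts arcs by (auto simp: subgraph_def compatible_def f_def)
  then show ?thesis
    using iso unfolding contains_copy_def digraph_iso_def by blast
qed

lemma connected_imp_arc:
  assumes F: "pair_graph F" and conn: "connected (with_proj F)"
    and i: "i \<in> pverts F" and card: "2 \<le> card (pverts F)"
  shows "\<exists>j. (i, j) \<in> parcs F"
proof -
  interpret F: pair_graph F by (fact F)
  have "\<not> pverts F \<subseteq> {i}"
    using card card_mono[of "{i}" "pverts F"] by auto
  then obtain k where k: "k \<in> pverts F" "k \<noteq> i"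
    by blast
  have "strongly_connected (with_proj F)"
    using F.symmetric_connected_imp_strongly_connected F.sym_arcs conn by blast
  then have "i \<rightarrow>\<^sup>*\<^bsub>with_proj F\<^esub> k"
    using i k by (auto simp: strongly_connected_def)
  then show ?thesis
    using k by (cases rule: F.converse_reachable_cases) auto
qed

definition nat_star :: "nat \<Rightarrow> nat pair_pre_digraph" where
  "nat_star n = \<lparr> pverts = {..n}, parcs = {0} \<times> {1..n} \<union> {1..n} \<times> {0} \<rparr>"

lemma pair_graph_nat_star: "pair_graph (nat_star n)"
  by unfold_locales (auto simp: nat_star_def symmetric_def sym_def)

text \<open>
  Every second vertex of a walk in a star is the centre, so a closed walk of length at least 3
  visits the centre twice.
\<close>

lemma nat_star_no_cycle:
  assumes cyc: "pre_digraph.cycle (with_proj (nat_star n)) p" and len: "3 \<le> length p"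
  shows False
proof -
  interpret F: pair_graph "nat_star n" by (rule pair_graph_nat_star)
  obtain e1 e2 e3 q where p: "p = e1 # e2 # e3 # q"
    using len by (auto simp: numeral_3_eq_3 Suc_le_length_iff)
  obtain u where walk: "F.awalk u p u" and dist: "distinct (tl (pawalk_verts u p))"
    using cyc by (auto simp: F.cycle_def)
  let ?vs = "pawalk_verts (snd e3) q"
  have rest: "F.awalk (snd e3) q u"
    using walk p by (auto simp: F.awalk_Cons_iff)
  have arcs: "e1 \<in> parcs (nat_star n)" "e2 \<in> parcs (nat_star n)" "e3 \<in> parcs (nat_star n)"
    and ends: "fst e1 = u" "fst e2 = snd e1" "fst e3 = snd e2"
    using walk p by (auto simp: F.awalk_Cons_iff)
  have notin: "snd e1 \<notin> set ?vs" "snd e2 \<notin> set ?vs"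
    using dist ends p by auto
  have "snd e3 \<in> set ?vs"
    using F.hd_in_awalk_verts(1)[OF rest] .
  moreover have "last ?vs = u"
    using rest by (rule F.awalkE')
  then have "u \<in> set ?vs"
    using last_in_set[OF F.awalk_verts_non_Nil[of "snd e3" q]] by simp
  moreover have "fst e = 0 \<longleftrightarrow> snd e \<noteq> 0" if "e \<in> parcs (nat_star n)" for e
    using that by (auto simp: nat_star_def)
  ultimately show False
    using arcs ends notin by metis
qed

lemma nat_star_in_trees: "nat_star n \<in> trees (Suc n)"
proof -
  interpret F: pair_graph "nat_star n" by (rule pair_graph_nat_star)
  have to0: "i \<rightarrow>\<^sup>*\<^bsub>with_proj (nat_star n)\<^esub> 0" if "i \<in> pverts (nat_star n)" for i
  proof (cases "i = 0")
    case True
    then show ?thesis using that by (auto intro: F.reachable_refl)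
  next
    case False
    then show ?thesis using that by (intro F.reachable_adjI) (auto simp: nat_star_def)
  qed
  have "strongly_connected (with_proj (nat_star n))"
  proof (rule strongly_connectedI)
    show "verts (with_proj (nat_star n)) \<noteq> {}" by (auto simp: nat_star_def)
    fix i j assume "i \<in> verts (with_proj (nat_star n))" "j \<in> verts (with_proj (nat_star n))"
    then show "i \<rightarrow>\<^sup>*\<^bsub>with_proj (nat_star n)\<^esub> j"
      using to0 F.symmetric_reachable' F.reachable_trans by (metis with_proj_simps(1))
  qed
  then have "connected (with_proj (nat_star n))"
    using F.reachable_mk_symmetric_eq by (auto simp: connected_def strongly_connected_def)
  then show ?thesis
    using pair_graph_nat_star nat_star_no_cycle
    by (auto simp: trees_def undirected_tree_def nat_star_def)
qed

section \<open>Transversals over a star\<close>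

locale star_host =
  fixes H :: "'a pair_pre_digraph" and c :: 'a and L :: "'a set"
  assumes finite_L: "finite L" and L_nonempty: "L \<noteq> {}" and c_notin: "c \<notin> L"
    and pverts_H: "pverts H = insert c L"
    and parcs_H: "parcs H = {c} \<times> L \<union> L \<times> {c}"
begin

lemma part_unique:
  assumes "partite_graph H G V w" "x \<in> pverts H" "y \<in> pverts H" "v \<in> V x" "v \<in> V y"
  shows "x = y"
  using assms by (auto simp: partite_graph_def disjoint_family_on_def)

text \<open>
  A central vertex with a neighbour in every leaf part forms a spanning star with these
  neighbours, so their transversal contains a tree on all its vertices.
\<close>

lemma missing_part_if_free:
  assumes G: "partite_graph H G V w"
    and free: "free_transversals (trees (Suc (card L))) H G V" and u: "u \<in> V c"
  shows "\<exists>x\<in>L. \<forall>v\<in>V x. (u, v) \<notin> parcs G"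
proof (rule ccontr)
  assume "\<not> ?thesis"
  then obtain f where f: "\<And>x. x \<in> L \<Longrightarrow> f x \<in> V x \<and> (u, f x) \<in> parcs G"
    by metis
  interpret G: pair_graph G using G by (simp add: partite_graph_def)
  define g where "g = f(c := u)"
  have g: "g x \<in> V x" if "x \<in> pverts H" for x
    using that f u by (auto simp: g_def pverts_H)
  have g_verts: "g ` pverts H \<subseteq> pverts G"
    using G g by (auto simp: partite_graph_def)
  have g_inj: "inj_on g (pverts H)"
    using g part_unique[OF G] by (metis inj_onI)
  have g_arcs: "(g c, g x) \<in> parcs G" "(g x, g c) \<in> parcs G" if "x \<in> L" for x
    using that f c_notin G.arcs_symmetric by (auto simp: g_def)
  let ?T = "with_proj G \<restriction> g ` pverts H"
  have "\<exists>!v. v \<in> g ` pverts H \<inter> V x" if x: "x \<in> pverts H" for x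
  proof (rule ex1I[of _ "g x"])
    show "g x \<in> g ` pverts H \<inter> V x" using x g by blast
    show "v = g x" if "v \<in> g ` pverts H \<inter> V x" for v
      using that x g part_unique[OF G] by blast
  qed
  then have T: "?T \<in> transversals H G V"
    using g_verts unfolding transversals_def mem_Collect_eq
    by (intro exI[of _ "g ` pverts H"] conjI ballI refl)
  obtain b where b: "bij_betw b {1..card L} L"
    using finite_L by (metis ex_bij_betw_finite_nat ex_bij_betw_nat_finite_1)
  define h where "h = b(0 := c)"
  have h: "h 0 = c" "\<And>i. i \<in> {1..card L} \<Longrightarrow> h i \<in> L"
    using b by (auto simp: h_def bij_betw_def)
  have h_inj: "inj_on h {..card L}"
  proof -
    have "inj_on h {1..card L}"
      using b by (subst inj_on_cong[of _ _ b]) (auto simp: h_def bij_betw_def)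
    moreover have "h 0 \<notin> h ` {1..card L}"
      using h c_notin by auto
    ultimately have "inj_on h (insert 0 {1..card L})"
      by simp
    also have "insert 0 {1..card L} = {..card L}" by auto
    finally show ?thesis .
  qed
  have h_verts: "h ` {..card L} \<subseteq> pverts H"
  proof (rule image_subsetI)
    fix i assume "i \<in> {..card L}"
    then show "h i \<in> pverts H"
      using h by (cases "i = 0") (auto simp: pverts_H)
  qed
  have "contains_copy ?T (with_proj (nat_star (card L)))"
  proof (rule contains_copyI[where \<phi> = "g \<circ> h"])
    show "pair_wf_digraph (nat_star (card L))"
      using pair_graph_nat_star by (simp add: pair_graph_def pair_digraph_def pair_fin_digraph_def)
    show "wf_digraph ?T" using g_verts by (intro G.wellformed_induce_subgraph)
    show "inj_on (g \<circ> h) (pverts (nat_star (card L)))"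
      using h_inj h_verts g_inj by (auto simp: nat_star_def intro: comp_inj_on inj_on_subset)
    show "(g \<circ> h) ` pverts (nat_star (card L)) \<subseteq> verts ?T"
      using h_verts by (auto simp: nat_star_def)
    show "((g \<circ> h) i, (g \<circ> h) j) \<in> arcs ?T" if "(i, j) \<in> parcs (nat_star (card L))" for i j
      using that h g_arcs by (auto simp: nat_star_def pverts_H)
  qed auto
  then show False
    using T free nat_star_in_trees by (auto simp: free_transversals_def)
qed

text \<open>
  A tree on as many vertices as there are parts would have to span the transversal, but the
  vertex in the leaf part missed by the central one has degree 0 there.
\<close>

lemma free_if_missing_part:
  assumes G: "partite_graph H G V w"
    and miss: "\<And>u. u \<in> V c \<Longrightarrow> \<exists>x\<in>L. \<forall>v\<in>V x. (u, v) \<notin> parcs G"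
  shows "free_transversals (trees (Suc (card L))) H G V"
  unfolding free_transversals_def
proof (intro ballI notI)
  fix T F
  assume T: "T \<in> transversals H G V" and F: "F \<in> trees (Suc (card L))"
    and copy: "contains_copy T (with_proj F)"
  interpret G: pair_graph G using G by (simp add: partite_graph_def)
  obtain S where S: "T = with_proj G \<restriction> S" "S \<subseteq> pverts G"
    and S_ex1: "\<And>x. x \<in> pverts H \<Longrightarrow> \<exists>!v. v \<in> S \<inter> V x"
    using T unfolding transversals_def mem_Collect_eq by metis
  have "\<exists>s. \<forall>x\<in>pverts H. S \<inter> V x = {s x}"
    using S_ex1 by (intro bchoice) blast
  then obtain s where s: "\<And>x. x \<in> pverts H \<Longrightarrow> S \<inter> V x = {s x}"
    by blast
  have "S = (\<Union>x\<in>pverts H. S \<inter> V x)"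
    using S(2) G unfolding partite_graph_def by blast
  also have "\<dots> = s ` pverts H"
    using s by auto
  finally have "card S \<le> Suc (card L)" and finS: "finite S"
    using card_image_le[of "pverts H" s] finite_L c_notin by (auto simp: pverts_H)
  obtain X f where X: "subgraph X T" and iso: "pre_digraph.digraph_isomorphism (with_proj F) f"
    and X_eq: "X = app_iso f (with_proj F)"
    using copy by (auto simp: contains_copy_def digraph_iso_def)
  have "card (verts X) = Suc (card L)"
    using F iso X_eq by (auto simp: pre_digraph.digraph_isomorphism_def card_image trees_def)
  then have X_verts: "verts X = S"
    using X S(1) finS \<open>card S \<le> Suc (card L)\<close>
    by (metis card_seteq induce_subgraph_verts subgraph_imp_subverts)
  have c: "c \<in> pverts H" by (simp add: pverts_H)
  have "s c \<in> S" "s c \<in> V c"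
    using s[OF c] by auto
  then obtain x where x: "x \<in> L" and no_arc: "\<And>v. v \<in> V x \<Longrightarrow> (s c, v) \<notin> parcs G"
    using miss by blast
  have xH: "x \<in> pverts H" using x by (simp add: pverts_H)
  have sx: "s x \<in> S" "s x \<in> V x" using s[OF xH] by auto
  obtain i where i: "i \<in> pverts F" "iso_verts f i = s x"
    using sx X_verts X_eq by auto
  have "2 \<le> card (pverts F)"
    using F finite_L L_nonempty by (auto simp: trees_def Suc_le_eq card_gt_0_iff)
  then obtain j where j: "(i, j) \<in> parcs F"
    using connected_imp_arc[of F i] F i by (auto simp: trees_def undirected_tree_def)
  define a where "a = iso_arcs f (i, j)"
  have "a \<in> arcs X" using j X_eq by (auto simp: a_def)
  moreover have "tail X = fst"
    using X S(1) by (auto simp: subgraph_def compatible_def)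
  moreover have "tail X a = s x"
    using pre_digraph.iso_verts_tail[OF iso, of "(i, j)"] j i X_eq by (simp add: a_def)
  ultimately obtain v where v: "(s x, v) \<in> parcs G" "v \<in> S"
    using X S(1) by (cases a) (auto simp: subgraph_def)
  then obtain y z where yz: "(y, z) \<in> parcs H" "s x \<in> V y" "v \<in> V z"
    using G by (fastforce simp: partite_graph_def)
  then have "y = x"
    using part_unique[OF G _ xH _ sx(2)] by (auto simp: parcs_H pverts_H)
  then have "z = c" using yz x c_notin by (auto simp: parcs_H)
  then have "v = s c" using s[OF c] v yz by auto
  then show False using no_arc sx v G.arcs_symmetric by blast
qed

theorem free_transversals_star_iff:
  assumes "partite_graph H G V w"
  shows "free_transversals (trees (Suc (card L))) H G V \<longleftrightarrow>
    (\<forall>u\<in>V c. \<exists>x\<in>L. \<forall>v\<in>V x. (u, v) \<notin> parcs G)"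
  using missing_part_if_free[OF assms] free_if_missing_part[OF assms] by blast

section \<open>The two bounds\<close>

lemma partite_density_star_le:
  assumes G: "partite_graph H G V w"
    and free: "free_transversals (trees (Suc (card L))) H G V"
  shows "partite_density H G V w \<le> (real (card L) - 1) / real (card L)"
proof -
  interpret G: pair_graph G using G by (simp add: partite_graph_def)
  let ?n = "card L" and ?d = "partite_density H G V w"
  define t where "t u x = (\<Sum>v\<in>V x. w v * of_bool ((u, v) \<in> parcs G))" for u x
  have n: "0 < ?n" using finite_L L_nonempty by (simp add: card_gt_0_iff)
  have w: "0 \<le> w v" if "v \<in> V x" "x \<in> pverts H" for v x
    using G that by (auto simp: partite_graph_def)
  have sum_w: "(\<Sum>v\<in>V x. w v) = 1" if "x \<in> pverts H" for x
    using G that by (auto simp: partite_graph_def)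
  have t_le: "t u x \<le> 1" if "x \<in> L" for u x
  proof -
    have "t u x \<le> (\<Sum>v\<in>V x. w v)"
      unfolding t_def using that w by (intro sum_mono) (auto simp: pverts_H)
    then show ?thesis using sum_w that by (simp add: pverts_H)
  qed
  have sum_t: "(\<Sum>x\<in>L. t u x) \<le> real ?n - 1" if u: "u \<in> V c" for u
  proof -
    obtain x where x: "x \<in> L" "\<And>v. v \<in> V x \<Longrightarrow> (u, v) \<notin> parcs G"
      using missing_part_if_free[OF G free u] by blast
    have "(\<Sum>y\<in>L. t u y) = t u x + (\<Sum>y\<in>L - {x}. t u y)"
      using finite_L x(1) by (rule sum.remove)
    also have "t u x = 0" using x(2) by (simp add: t_def)
    also have "(\<Sum>y\<in>L - {x}. t u y) \<le> (\<Sum>y\<in>L - {x}. 1)"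
      using t_le by (intro sum_mono) auto
    finally show ?thesis using x(1) finite_L n by (simp add: of_nat_diff)
  qed
  have "?d \<le> edge_density G V w c x" if "x \<in> L" for x
    unfolding partite_density_def using that finite_L
    by (intro Min_le) (auto simp: parcs_H intro!: image_eqI[where x = "(c, x)"])
  then have "real ?n * ?d \<le> (\<Sum>x\<in>L. edge_density G V w c x)"
    using sum_mono[of L "\<lambda>_. ?d"] by simp
  also have "\<dots> = (\<Sum>x\<in>L. \<Sum>u\<in>V c. w u * t u x)"
    by (simp add: edge_density_def t_def sum_distrib_left mult.assoc)
  also have "\<dots> = (\<Sum>u\<in>V c. w u * (\<Sum>x\<in>L. t u x))"
    by (subst sum.swap) (simp add: sum_distrib_left)
  also have "\<dots> \<le> (\<Sum>u\<in>V c. w u * (real ?n - 1))"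
    using w sum_t by (intro sum_mono mult_left_mono) (auto simp: pverts_H)
  also have "\<dots> = real ?n - 1"
    using sum_w[of c] by (simp add: sum_distrib_right[symmetric] pverts_H)
  finally show ?thesis
    using n by (simp add: pos_le_divide_eq mult.commute)
qed

text \<open>
  The central part is \<open>{..<n}\<close>, and the part of the \<open>j\<close>-th leaf is the single vertex \<open>n + j\<close>,
  which is joined to all central vertices except \<open>j\<close>.
\<close>

lemma extremal_star_graph:
  obtains G :: "nat pair_pre_digraph" and V w
  where "partite_graph H G V w" "free_transversals (trees (Suc (card L))) H G V"
    "partite_density H G V w = (real (card L) - 1) / real (card L)"
proof -
  define n where "n = card L"
  have n: "0 < n" using finite_L L_nonempty by (simp add: n_def card_gt_0_iff)
  obtain idx where idx: "bij_betw idx L {..<n}"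
    using finite_L ex_bij_betw_finite_nat unfolding n_def by (metis atLeast0LessThan)
  have idx_lt: "idx x < n" if "x \<in> L" for x
    using idx that by (auto simp: bij_betw_def)
  have idx_inj: "x = y" if "idx x = idx y" "x \<in> L" "y \<in> L" for x y
    using idx that by (auto simp: bij_betw_def inj_on_def)
  define E where "E = {(i, n + j) | i j. i < n \<and> j < n \<and> i \<noteq> j}"
  define G where "G = \<lparr> pverts = {..<n + n}, parcs = E \<union> E\<inverse> \<rparr>"
  define V where "V x = (if x = c then {..<n} else {n + idx x})" for x
  define w where "w i = (if i < n then 1 / real n else 1)" for i
  have Vc: "V c = {..<n}" and VL: "\<And>x. x \<in> L \<Longrightarrow> V x = {n + idx x}"
    using c_notin by (auto simp: V_def)
  have "finite E"
    by (rule finite_subset[of _ "{..<n} \<times> {..<n + n}"]) (auto simp: E_def)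
  then interpret G: pair_graph G
    by unfold_locales (auto simp: G_def E_def symmetric_def sym_def)
  have leaf: "\<exists>x\<in>L. idx x = j" if "j < n" for j
    using idx that by (metis bij_betw_iff_bijections lessThan_iff)
  have verts: "pverts G = (\<Union>x\<in>pverts H. V x)"
  proof (intro equalityI subsetI)
    fix i assume i: "i \<in> pverts G"
    show "i \<in> (\<Union>x\<in>pverts H. V x)"
    proof (cases "i < n")
      case True
      then show ?thesis by (auto simp: pverts_H Vc)
    next
      case False
      then have "i - n < n"
        using i by (auto simp: G_def)
      then obtain x where "x \<in> L" "idx x = i - n"
        using leaf by blast
      then show ?thesis using False VL[of x] by (intro UN_I[of x]) (auto simp: pverts_H)
    qed
  next
    fix i assume "i \<in> (\<Union>x\<in>pverts H. V x)"
    then consider "i < n" | x where "x \<in> L" "i = n + idx x"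
      by (auto simp: pverts_H Vc VL)
    then show "i \<in> pverts G"
      using idx_lt by cases (auto simp: G_def)
  qed
  have arcs: "\<exists>(x, y)\<in>parcs H. i \<in> V x \<and> k \<in> V y" if ik: "(i, k) \<in> parcs G" for i k
  proof -
    consider j where "k = n + j" "i < n" "j < n" | j where "i = n + j" "k < n" "j < n"
      using ik by (auto simp: G_def E_def)
    then show ?thesis
    proof cases
      case 1
      then obtain x where "x \<in> L" "idx x = j" using leaf by blast
      then show ?thesis using 1 by (intro bexI[of _ "(c, x)"]) (auto simp: parcs_H Vc VL)
    next
      case 2
      then obtain x where "x \<in> L" "idx x = j" using leaf by blast
      then show ?thesis using 2 by (intro bexI[of _ "(x, c)"]) (auto simp: parcs_H Vc VL)
    qed
  qed
  have "disjoint_family_on V (pverts H)"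
    using idx_inj by (auto simp: disjoint_family_on_def V_def pverts_H)
  moreover have "\<forall>x\<in>pverts H. (\<Sum>v\<in>V x. w v) = 1"
    using n by (auto simp: V_def w_def)
  moreover have "\<forall>v\<in>pverts G. 0 \<le> w v \<and> w v \<le> 1"
    using n by (auto simp: w_def)
  ultimately have G: "partite_graph H G V w"
    using G.pair_graph verts arcs unfolding partite_graph_def by blast
  have "\<exists>x\<in>L. \<forall>v\<in>V x. (u, v) \<notin> parcs G" if "u \<in> V c" for u
  proof -
    have "u < n" using that by (simp add: Vc)
    then obtain x where "x \<in> L" "idx x = u" using leaf by blast
    then show ?thesis by (intro bexI[of _ x]) (auto simp: VL G_def E_def)
  qed
  then have free: "free_transversals (trees (Suc (card L))) H G V"
    using free_transversals_star_iff[OF G] by blast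
  have dens: "edge_density G V w c x = (real n - 1) / real n" if x: "x \<in> L" for x
  proof -
    have "edge_density G V w c x = (\<Sum>i<n. if i \<noteq> idx x then 1 / real n else 0)"
      unfolding edge_density_def Vc VL[OF x] using idx_lt[OF x]
      by (intro sum.cong) (auto simp: w_def G_def E_def)
    also have "\<dots> = (\<Sum>i\<in>{..<n} - {idx x}. 1 / real n)"
      by (intro sum.mono_neutral_cong_right) auto
    also have "\<dots> = (real n - 1) / real n"
      using idx_lt[OF x] n by (simp add: of_nat_diff)
    finally show ?thesis .
  qed
  have arcs_commute: "(u, v) \<in> parcs G \<longleftrightarrow> (v, u) \<in> parcs G" for u v
    using G.arcs_symmetric by blast
  have "edge_density G V w x c = edge_density G V w c x" for x
    unfolding edge_density_def
    by (subst sum.swap, intro sum.cong refl, subst arcs_commute) (simp add: mult.commute)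
  then have "edge_density G V w x y = (real n - 1) / real n" if "(x, y) \<in> parcs H" for x y
    using that dens by (auto simp: parcs_H)
  then have "(\<lambda>(x, y). edge_density G V w x y) ` parcs H = (\<lambda>_. (real n - 1) / real n) ` parcs H"
    by (intro image_cong) auto
  moreover have "parcs H \<noteq> {}" using L_nonempty by (simp add: parcs_H)
  ultimately have "partite_density H G V w = (real n - 1) / real n"
    by (simp add: partite_density_def image_constant_conv)
  then show thesis
    using that G free unfolding n_def by blast
qed

theorem partite_turan_density_star:
  "partite_turan_density H (trees (Suc (card L))) = (real (card L) - 1) / real (card L)"
  unfolding partite_turan_density_def
proof (rule cSup_eq_maximum)
  obtain G :: "nat pair_pre_digraph" and V w
    where "partite_graph H G V w" "free_transversals (trees (Suc (card L))) H G V"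
    "partite_density H G V w = (real (card L) - 1) / real (card L)"
    by (rule extremal_star_graph)
  then show "(real (card L) - 1) / real (card L) \<in> {partite_density H G V w |
      (G :: nat pair_pre_digraph) V w.
      partite_graph H G V w \<and> free_transversals (trees (Suc (card L))) H G V}"
    by (intro CollectI exI[of _ G] exI[of _ V] exI[of _ w]) simp
next
  fix d
  assume "d \<in> {partite_density H G V w | (G :: nat pair_pre_digraph) V w.
      partite_graph H G V w \<and> free_transversals (trees (Suc (card L))) H G V}"
  then obtain G :: "nat pair_pre_digraph" and V w where "d = partite_density H G V w"
    "partite_graph H G V w" "free_transversals (trees (Suc (card L))) H G V"
    by (elim CollectE exE conjE)
  then show "d \<le> (real (card L) - 1) / real (card L)"
    using partite_density_star_le by simp
qed

end

theorem proposition1p11: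
  fixes r :: nat and H :: "'a pair_pre_digraph"
  assumes "r \<ge> 2"
    and "K\<^bsub>1,r - 1\<^esub> (with_proj H)"
  shows "partite_turan_density H (trees r) = (real r - 2) / (real r - 1)"
proof -
  obtain U L where H: "finite (pverts H)" "pverts H = U \<union> L" "U \<inter> L = {}" "card U = 1"
    "card L = r - 1" "parcs H = U \<times> L \<union> L \<times> U"
    using assms(2) unfolding complete_bipartite_digraph_pair_def by (elim conjE exE)
  then obtain c where c: "U = {c}" by (auto simp: card_1_singleton_iff)
  interpret star_host H c L
  proof
    show "finite L" "L \<noteq> {}"
      using H(1,2,5) assms(1) by auto
    show "c \<notin> L" "pverts H = insert c L" "parcs H = {c} \<times> L \<union> L \<times> {c}"
      using H(2,3,6) c by auto
  qed
  show ?thesis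
    using partite_turan_density_star H(5) assms(1) by (simp add: of_nat_diff)
qed

end
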